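(* Let $K$ be a real number field and let $\alpha_1,\dots,\alpha_n\in\mathfrak{O}_K^+$ be nonzero elements that generate $\mathfrak{O}_K$ as a $\mathbb{Z}$-module. Then the set $\mathfrak{M}(\alpha_1,\dots,\alpha_n)$ of maximal elements of $\mathrm{Frob}(\alpha_1,\dots,\alpha_n)$ with respect to $\preccurlyeq$ is finite, and $$\mathrm{Frob}(\alpha_1,\dots,\alpha_n)=\bigcup_{\mu\in\mathfrak{M}(\alpha_1,\dots,\alpha_n)}\big(\mu+C_\mathbb{Q}(\alpha_1,\dots,\alpha_n)\cap\mathfrak{O}_K\big).$$
   Context: A real number field is a number field that is a subfield of $\mathbb{R}$; $\mathfrak{O}_K$ is its ring of integers and $\mathfrak{O}_K^+=\mathfrak{O}_K\cap[0,\infty)$. $\mathbb{N}=\{0,1,2,\dots\}$. For $\alpha_1,\dots,\alpha_n\in\mathfrak{O}_K^+$: $\mathrm{SG}(\alpha_1,\dots,\alpha_n)=\{\sum x_i\alpha_i\mid x_i\in\mathbb{N}\}$; $C_\mathbb{Q}(\alpha_1,\dots,\alpha_n)=\{\sum x_i\alpha_i\mid x_i\in\mathbb{Q}_{\geqslant0}\}$; $\mathrm{Frob}(\alpha_1,\dots,\alpha_n)=\{w\in\mathrm{SG}(\alpha_1,\dots,\alpha_n)\mid w+(C_\mathbb{Q}(\alpha_1,\dots,\alpha_n)\cap\mathfrak{O}_K)\subseteq \mathrm{SG}(\alpha_1,\dots,\alpha_n)\}$. The partial order $\preccurlyeq$ on $\mathrm{Frob}(\alpha_1,\dots,\alpha_n)$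 is defined by $w\preccurlyeq v$ iff $w+(C_\mathbb{Q}(\alpha_1,\dots,\alpha_n)\cap\mathfrak{O}_K)\subseteq v+(C_\mathbb{Q}(\alpha_1,\dots,\alpha_n)\cap\mathfrak{O}_K)$. $\mathfrak{M}(\alpha_1,\dots,\alpha_n)$ denotes the set of elements of $\mathrm{Frob}(\alpha_1,\dots,\alpha_n)$ that are maximal with respect to $\preccurlyeq$. *)

theory Defs
  imports Complex_Main "HOL-Computational_Algebra.Polynomial"
begin

interpretation rat_real: vector_space "\<lambda>(q::rat) (x::real). of_rat q * x"
  by unfold_locales (simp_all add: algebra_simps of_rat_add of_rat_mult)

interpretation int_real: module "\<lambda>(k::int) (x::real). of_int k * x"
  by unfold_locales (simp_all add: algebra_simps)

definition real_subfield :: "real set \<Rightarrow> bool" where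
  "real_subfield K \<longleftrightarrow>
     0 \<in> K \<and> 1 \<in> K \<and>
     (\<forall>x\<in>K. \<forall>y\<in>K. x + y \<in> K \<and> x * y \<in> K) \<and>
     (\<forall>x\<in>K. - x \<in> K) \<and>
     (\<forall>x\<in>K. x \<noteq> 0 \<longrightarrow> inverse x \<in> K)"

text \<open>A finite spanning set over the rationals expresses that the extension has finite degree.\<close>

definition real_number_field :: "real set \<Rightarrow> bool" where
  "real_number_field K \<longleftrightarrow> real_subfield K \<and> (\<exists>B. finite B \<and> rat_real.span B = K)"

definition ring_of_integers :: "real set \<Rightarrow> real set" where
  "ring_of_integers K = {x \<in> K. algebraic_int x}"

definition nonneg_integers :: "real set \<Rightarrow> real set" where
  "nonneg_integers K = ring_of_integers K \<inter> {0..}"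

text \<open>A finite sequence of generators is a pair of its length \<open>n\<close> and a function \<open>\<alpha>\<close>
  of which only the values at \<open>1, \<dots>, n\<close> matter.\<close>

definition SG :: "nat \<Rightarrow> (nat \<Rightarrow> real) \<Rightarrow> real set" where
  "SG n \<alpha> = {(\<Sum>i=1..n. of_nat (x i) * \<alpha> i) | x :: nat \<Rightarrow> nat. True}"

definition C_Q :: "nat \<Rightarrow> (nat \<Rightarrow> real) \<Rightarrow> real set" where
  "C_Q n \<alpha> = {(\<Sum>i=1..n. of_rat (x i) * \<alpha> i) | x :: nat \<Rightarrow> rat. \<forall>i\<in>{1..n}. 0 \<le> x i}"

definition Frob :: "real set \<Rightarrow> nat \<Rightarrow> (nat \<Rightarrow> real) \<Rightarrow> real set" where
  "Frob K n \<alpha> =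
     {w \<in> SG n \<alpha>. (+) w ` (C_Q n \<alpha> \<inter> ring_of_integers K) \<subseteq> SG n \<alpha>}"

definition frob_le :: "real set \<Rightarrow> nat \<Rightarrow> (nat \<Rightarrow> real) \<Rightarrow> real \<Rightarrow> real \<Rightarrow> bool" where
  "frob_le K n \<alpha> w v \<longleftrightarrow>
     (+) w ` (C_Q n \<alpha> \<inter> ring_of_integers K) \<subseteq> (+) v ` (C_Q n \<alpha> \<inter> ring_of_integers K)"

definition maximal_Frob :: "real set \<Rightarrow> nat \<Rightarrow> (nat \<Rightarrow> real) \<Rightarrow> real set" where
  "maximal_Frob K n \<alpha> =
     {\<mu> \<in> Frob K n \<alpha>. \<forall>v \<in> Frob K n \<alpha>. frob_le K n \<alpha> \<mu> v \<longrightarrow> v = \<mu>}"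

end

(* Dickson's lemma does all the work: in any sequence of elements of the semigroup S = SG n \<alpha>
   some later term exceeds an earlier one by an element of S. Write C for the set of integers of
   the cone. It contains S, is closed under addition and consists of nonnegative reals, and
   w \<preccurlyeq> v means w - v \<in> C. Hence distinct maximal elements cannot form an infinite sequence, and
   since S is well-ordered by the order of the reals, every w in Frob lies above some v \<in> Frob
   with w - v \<in> C that is least as a real number, and such a v is maximal. *)

theory Submission
  imports Defs
begin

text \<open>Every sequence has a monotone subsequence, and a decreasing one of natural numbers
  becomes constant once it attains its minimum, so its tail is increasing as well.\<close>

lemma nat_seq_incseq_subseq:
  fixes f :: "nat \<Rightarrow> nat"
  shows "\<exists>r. strict_mono r \<and> incseq (f \<circ> r)"
proof -
  obtain r :: "nat \<Rightarrow> nat" where r: "strict_mono r" "monoseq (\<lambda>k. f (r k))"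
    using seq_monosub[of f] by blast
  show ?thesis
  proof (cases "incseq (\<lambda>k. f (r k))")
    case True
    with r(1) show ?thesis by (auto simp: o_def)
  next
    case False
    with r(2) have dec: "decseq (\<lambda>k. f (r k))"
      by (simp add: monoseq_iff)
    \<comment> \<open>The minimum of the subsequence is attained at \<open>m\<close>; shifting by
      \<open>m\<close> leaves a constant sequence.\<close>
    obtain m where m: "\<And>k. f (r m) \<le> f (r k)"
      using ex_has_least_nat[of "\<lambda>_. True" 0 "\<lambda>k. f (r k)"] by blast
    have "f (r (k + m)) = f (r m)" for k
      using m[of "k + m"] decseqD[OF dec, of m "k + m"] by simp
    moreover have "strict_mono (\<lambda>k. r (k + m))"
      using r(1) by (simp add: strict_mono_def)
    ultimately show ?thesis
      by (intro exI[of _ "\<lambda>k. r (k + m)"]) (simp add: incseq_def)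
  qed
qed

text \<open>Coordinates are treated one at a time: thinning the sequence out for a new coordinate
  keeps the earlier ones increasing. This is the sequence form of Dickson's lemma.\<close>

lemma dickson_subseq:
  fixes f :: "nat \<Rightarrow> 'a \<Rightarrow> nat"
  assumes "finite I"
  shows "\<exists>r. strict_mono r \<and> (\<forall>i\<in>I. incseq (\<lambda>k. f (r k) i))"
  using assms
proof induction
  case empty
  show ?case by (auto intro: strict_mono_id)
next
  case (insert a I)
  then obtain r where r: "strict_mono r" "\<forall>i\<in>I. incseq (\<lambda>k. f (r k) i)" by blast
  obtain s where s: "strict_mono s" "incseq ((\<lambda>k. f (r k) a) \<circ> s)"
    using nat_seq_incseq_subseq by blast
  have "incseq (\<lambda>k. f (r (s k)) i)" if "i \<in> insert a I" for i
    using that r(2) s strict_mono_mono[OF s(1)]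
    by (auto simp: o_def incseq_def mono_def)
  with strict_mono_o[OF r(1) s(1)] show ?case
    by (intro exI[of _ "r \<circ> s"]) (simp add: o_def)
qed

lemma SG_seq_good_pair:
  fixes f :: "nat \<Rightarrow> real"
  assumes "\<And>k. f k \<in> SG n \<alpha>"
  shows "\<exists>i j. i < j \<and> f j - f i \<in> SG n \<alpha>"
proof -
  have "\<exists>x. f k = (\<Sum>i=1..n. of_nat (x i) * \<alpha> i)" for k
    using assms[of k] by (auto simp: SG_def)
  then obtain x where x: "\<And>k. f k = (\<Sum>i=1..n. of_nat (x k i) * \<alpha> i)" by metis
  obtain r :: "nat \<Rightarrow> nat" where r: "strict_mono r" "\<forall>i\<in>{1..n}. incseq (\<lambda>k. x (r k) i)"
    using dickson_subseq[of "{1..n}" x] by blast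
  \<comment> \<open>The truncated subtraction on the naturals is exact here, since each coefficient
    at \<open>r 1\<close> is at least the one at \<open>r 0\<close>. Hence the difference has
    natural coefficients.\<close>
  have "f (r 1) - f (r 0) = (\<Sum>i=1..n. of_nat (x (r 1) i - x (r 0) i) * \<alpha> i)"
    using r(2) unfolding x sum_subtractf[symmetric]
    by (intro sum.cong) (auto simp: incseq_def of_nat_diff algebra_simps)
  then have "f (r 1) - f (r 0) \<in> SG n \<alpha>"
    by (auto simp: SG_def)
  moreover have "r 0 < r 1"
    using r(1) by (simp add: strict_mono_def)
  ultimately show ?thesis by blast
qed

lemma SG_subset_C_Q: "SG n \<alpha> \<subseteq> C_Q n \<alpha>"
proof
  fix w assume "w \<in> SG n \<alpha>"
  then obtain x :: "nat \<Rightarrow> nat" where "w = (\<Sum>i=1..n. of_nat (x i) * \<alpha> i)"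
    by (auto simp: SG_def)
  then show "w \<in> C_Q n \<alpha>"
    unfolding C_Q_def by (intro CollectI exI[of _ "\<lambda>i. of_nat (x i)"]) simp
qed

lemma SG_subset_span: "SG n \<alpha> \<subseteq> int_real.span (\<alpha> ` {1..n})"
proof
  fix w assume "w \<in> SG n \<alpha>"
  then obtain x :: "nat \<Rightarrow> nat" where w: "w = (\<Sum>i=1..n. of_nat (x i) * \<alpha> i)"
    by (auto simp: SG_def)
  have "(\<Sum>i=1..n. of_int (int (x i)) * \<alpha> i) \<in> int_real.span (\<alpha> ` {1..n})"
    by (intro int_real.span_sum int_real.span_scale int_real.span_base) simp
  with w show "w \<in> int_real.span (\<alpha> ` {1..n})" by simp
qed

lemma C_Q_nonneg:
  assumes "\<And>i. i \<in> {1..n} \<Longrightarrow> 0 \<le> \<alpha> i" "c \<in> C_Q n \<alpha>"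
  shows "0 \<le> c"
  using assms by (auto simp: C_Q_def intro!: sum_nonneg mult_nonneg_nonneg)

lemma C_Q_add:
  assumes "c \<in> C_Q n \<alpha>" "d \<in> C_Q n \<alpha>"
  shows "c + d \<in> C_Q n \<alpha>"
proof -
  obtain x y :: "nat \<Rightarrow> rat" where
    x: "c = (\<Sum>i=1..n. of_rat (x i) * \<alpha> i)" "\<forall>i\<in>{1..n}. 0 \<le> x i" and
    y: "d = (\<Sum>i=1..n. of_rat (y i) * \<alpha> i)" "\<forall>i\<in>{1..n}. 0 \<le> y i"
    using assms by (auto simp: C_Q_def)
  then show ?thesis
    unfolding C_Q_def
    by (intro CollectI exI[of _ "\<lambda>i. x i + y i"])
       (simp add: of_rat_add distrib_right sum.distrib)
qed

lemma zero_in_C_Q: "0 \<in> C_Q n \<alpha>"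
  unfolding C_Q_def by (intro CollectI exI[of _ "\<lambda>_. 0"]) simp

text \<open>As \<open>C\<close> contains 0, the left inclusion already puts \<open>w\<close> itself
  into the translate by \<open>v\<close>; closure under addition gives the converse. This turns the
  order on Frob into membership of a difference.\<close>

lemma translate_subset_iff:
  fixes C :: "'a::ab_group_add set"
  assumes "0 \<in> C" "\<And>c d. c \<in> C \<Longrightarrow> d \<in> C \<Longrightarrow> c + d \<in> C"
  shows "(+) w ` C \<subseteq> (+) v ` C \<longleftrightarrow> w - v \<in> C"
proof
  assume "(+) w ` C \<subseteq> (+) v ` C"
  moreover have "w \<in> (+) w ` C" using assms(1) by force
  ultimately show "w - v \<in> C" by auto
next
  assume *: "w - v \<in> C"
  show "(+) w ` C \<subseteq> (+) v ` C"
  proof clarify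
    fix c assume "c \<in> C"
    then have "(w - v) + c \<in> C" using * assms(2) by blast
    then have "v + ((w - v) + c) \<in> (+) v ` C" by blast
    then show "w + c \<in> (+) v ` C" by (simp add: algebra_simps)
  qed
qed

theorem theorem2:
  fixes K :: "real set" and n :: nat and \<alpha> :: "nat \<Rightarrow> real"
  assumes "real_number_field K"
    and "\<And>i. i \<in> {1..n} \<Longrightarrow> \<alpha> i \<in> nonneg_integers K"
    and "\<And>i. i \<in> {1..n} \<Longrightarrow> \<alpha> i \<noteq> 0"
    and "int_real.span (\<alpha> ` {1..n}) = ring_of_integers K"
  shows "finite (maximal_Frob K n \<alpha>) \<and>
    Frob K n \<alpha> =
      (\<Union>\<mu>\<in>maximal_Frob K n \<alpha>. (+) \<mu> ` (C_Q n \<alpha> \<inter> ring_of_integers K))"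
proof -
  define C where "C = C_Q n \<alpha> \<inter> ring_of_integers K"
  define S where "S = SG n \<alpha>"
  define F where "F = Frob K n \<alpha>"
  define M where "M = maximal_Frob K n \<alpha>"
  have nonneg: "0 \<le> \<alpha> i" if "i \<in> {1..n}" for i
    using assms(2)[OF that] by (simp add: nonneg_integers_def)
  have C_nonneg: "0 \<le> c" if "c \<in> C" for c
    using that C_Q_nonneg[of n \<alpha> c] nonneg by (auto simp: C_def)
  \<comment> \<open>That the ring of integers contains 0 and is closed under addition is read off
    from its being the span of the generators, with no theory of algebraic integers.\<close>
  have C_0: "0 \<in> C"
    using zero_in_C_Q int_real.span_zero[of "\<alpha> ` {1..n}"] assms(4) by (simp add: C_def)
  have C_add: "c + d \<in> C" if "c \<in> C" "d \<in> C" for c d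
    using that C_Q_add int_real.span_add[of c "\<alpha> ` {1..n}" d] assms(4) by (simp add: C_def)
  have S_C: "S \<subseteq> C"
    using SG_subset_C_Q SG_subset_span assms(4) unfolding S_def C_def by blast
  have F_iff: "w \<in> F \<longleftrightarrow> w \<in> S \<and> (\<forall>c\<in>C. w + c \<in> S)" for w
    by (auto simp: F_def Frob_def S_def C_def)
  have F_S: "w \<in> S" if "w \<in> F" for w using that F_iff by simp
  have F_add: "w + c \<in> F" if "w \<in> F" "c \<in> C" for w c
    using that C_add by (auto simp: F_iff add.assoc)
  have le_iff: "frob_le K n \<alpha> w v \<longleftrightarrow> w - v \<in> C" for w v
    unfolding frob_le_def C_def[symmetric] using C_0 C_add by (rule translate_subset_iff)
  have M_iff: "m \<in> M \<longleftrightarrow> m \<in> F \<and> (\<forall>v\<in>F. m - v \<in> C \<longrightarrow> v = m)" for m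
    by (simp add: M_def F_def maximal_Frob_def le_iff)
  have good_pair: "\<exists>i j. i < j \<and> f j - f i \<in> C" if "\<And>k. f k \<in> S" for f :: "nat \<Rightarrow> real"
    using SG_seq_good_pair[of f n \<alpha>] that S_C unfolding S_def by blast

  have "finite M"
  proof (rule ccontr)
    assume "infinite M"
    then obtain f :: "nat \<Rightarrow> real" where f: "inj f" "range f \<subseteq> M"
      using infinite_countable_subset by blast
    then have fM: "f k \<in> M" for k by blast
    then have fF: "f k \<in> F" for k using M_iff by simp
    \<comment> \<open>Here \<open>f i\<close> lies above \<open>f j\<close> in the order, so
      maximality of \<open>f j\<close> forces them to be equal, against injectivity.\<close>
    then obtain i j where "i < j" "f j - f i \<in> C"
      using good_pair[of f] F_S by blast
    then have "f i = f j" using fM[of j] fF[of i] by (simp add: M_iff)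
    with f(1) \<open>i < j\<close> show False by (auto dest: injD)
  qed
  moreover have "F = (\<Union>\<mu>\<in>M. (+) \<mu> ` C)"
  proof
    show "(\<Union>\<mu>\<in>M. (+) \<mu> ` C) \<subseteq> F"
      using F_add by (auto simp: M_iff)
  next
    have wf: "wf {(v, u). v \<in> S \<and> u \<in> S \<and> v < u}"
      unfolding wf_iff_no_infinite_down_chain
    proof
      assume "\<exists>f. \<forall>k. (f (Suc k), f k) \<in> {(v, u). v \<in> S \<and> u \<in> S \<and> v < u}"
      then obtain f where *: "\<forall>k. f (Suc k) \<in> S \<and> f k \<in> S \<and> f (Suc k) < f k"
        by auto
      then obtain i j where ij: "i < j" "f j - f i \<in> C"
        using good_pair[of f] by blast
      \<comment> \<open>The sequence is negated because the lifting lemma is about increasing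
        sequences.\<close>
      have "f j < f i"
        using lift_Suc_mono_less[of "\<lambda>k. - f k" i j] * ij(1) by simp
      with C_nonneg[OF ij(2)] show False by simp
    qed
    show "F \<subseteq> (\<Union>\<mu>\<in>M. (+) \<mu> ` C)"
    proof
      fix w assume "w \<in> F"
      then have "w \<in> {v \<in> F. w - v \<in> C}" using C_0 by simp
      from wfE_min[OF wf this] obtain v where v: "v \<in> F" "w - v \<in> C"
        and min: "\<And>u. (u, v) \<in> {(v, u). v \<in> S \<and> u \<in> S \<and> v < u} \<Longrightarrow>
                    u \<notin> {v \<in> F. w - v \<in> C}"
        by auto
      \<comment> \<open>Any \<open>u\<close> above \<open>v\<close> is also above \<open>w\<close>,
        so it competes with \<open>v\<close> for being least and is not smaller as a real; but
        \<open>v - u\<close> in \<open>C\<close> is nonnegative, so it is not larger either.\<close>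
      have "u = v" if "u \<in> F" "v - u \<in> C" for u
      proof -
        have "w - u \<in> C" using C_add[OF v(2) that(2)] by simp
        then have "\<not> u < v" using min[of u] that(1) v(1) F_S by auto
        with C_nonneg[OF that(2)] show ?thesis by simp
      qed
      then have "v \<in> M" using v(1) M_iff by blast
      moreover have "w \<in> (+) v ` C" using v(2) by (force simp: image_iff)
      ultimately show "w \<in> (\<Union>\<mu>\<in>M. (+) \<mu> ` C)" by blast
    qed
  qed
  ultimately show ?thesis unfolding M_def F_def C_def by simp
qed

end
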